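(* For every graph $H$ with $\chi(H)\ge 3$, we have $\delta_{\mathrm{B}}(H)>0$. Equivalently, $0\notin \Delta_{\mathrm{B}}:=\{\delta_{\mathrm{B}}(H):\chi(H)\ge 3\}$.
   Context: All graphs are finite and simple; $\chi$ is the chromatic number and $\delta(G)$ is the minimum degree of $G$. A graph $G$ is $H$-free if it contains no (not necessarily induced) subgraph isomorphic to $H$; it is maximal $H$-free if it is $H$-free and adding any missing edge on the same vertex set creates a copy of $H$. A blowup of a graph $F$ is obtained by replacing every vertex of $F$ by an independent set (possibly empty) and every edge of $F$ by a complete bipartite graph between the corresponding sets, with no other edges; $G=F[\cdot]$ means that $G$ is some blowup of $F$. The blowup threshold of $H$ is $$\delta_{\mathrm{B}}(H):=\inf\{\alpha\ge 0:\ \exists\,F=F(\alpha,H)\text{ such that every maximal }H\text{-free graph }G\text{ with }\delta(G)\ge\alpha|V(G)|\text{ satisfies }G=F[\cdot]\},$$ where $F$ is a (finite) graph. *)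

theory Defs
  imports Complex_Main "Graph_Theory.Graph_Theory"
begin

text \<open>
  A finite simple graph is a \<^term>\<open>G :: 'a pair_pre_digraph\<close> satisfying \<^const>\<open>pair_graph\<close>:
  an undirected edge is represented by the two arcs \<open>(u, v)\<close> and \<open>(v, u)\<close>.
\<close>

definition proper_coloring :: "'a pair_pre_digraph \<Rightarrow> nat \<Rightarrow> ('a \<Rightarrow> nat) \<Rightarrow> bool" where
  "proper_coloring G k c \<longleftrightarrow>
     (\<forall>v\<in>pverts G. c v < k) \<and> (\<forall>(u, v)\<in>parcs G. c u \<noteq> c v)"

definition chromatic_number :: "'a pair_pre_digraph \<Rightarrow> nat" where
  "chromatic_number G = (LEAST k. \<exists>c. proper_coloring G k c)"

text \<open>
  As the arcs come in symmetric pairs, the out-degree is the degree. \<^term>\<open>Min {}\<close> is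
  unspecified, so the graph without vertices is given minimum degree 0.
\<close>

definition min_degree :: "'a pair_pre_digraph \<Rightarrow> nat" where
  "min_degree G =
     (if pverts G = {} then 0 else Min (out_degree (with_proj G) ` pverts G))"

definition contains_copy :: "'a pair_pre_digraph \<Rightarrow> 'b pair_pre_digraph \<Rightarrow> bool" where
  "contains_copy H G \<longleftrightarrow>
     (\<exists>K :: 'b pair_pre_digraph.
        subgraph (with_proj K) (with_proj G) \<and> digraph_iso (with_proj H) (with_proj K))"

definition add_edge :: "'a pair_pre_digraph \<Rightarrow> 'a \<Rightarrow> 'a \<Rightarrow> 'a pair_pre_digraph" where
  "add_edge G u v = G\<lparr>parcs := parcs G \<union> {(u, v), (v, u)}\<rparr>"

definition maximal_free :: "'a pair_pre_digraph \<Rightarrow> 'b pair_pre_digraph \<Rightarrow> bool" where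
  "maximal_free H G \<longleftrightarrow>
     \<not> contains_copy H G \<and>
     (\<forall>u\<in>pverts G. \<forall>v\<in>pverts G.
        u \<noteq> v \<and> (u, v) \<notin> parcs G \<longrightarrow> contains_copy H (add_edge G u v))"

text \<open>
  \<open>B x\<close> is the (possibly empty) set replacing the vertex \<open>x\<close> of \<open>F\<close>. These sets are
  independent in \<open>G\<close> because they are disjoint and \<open>F\<close> has no loops.
\<close>

definition is_blowup :: "'a pair_pre_digraph \<Rightarrow> 'b pair_pre_digraph \<Rightarrow> bool" where
  "is_blowup F G \<longleftrightarrow>
     (\<exists>B :: 'a \<Rightarrow> 'b set.
        disjoint_family_on B (pverts F) \<and>
        pverts G = (\<Union>x\<in>pverts F. B x) \<and>
        parcs G = (\<Union>(x, y)\<in>parcs F. B x \<times> B y))"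

text \<open>
  Every finite graph is isomorphic to one on natural numbers, so \<open>F\<close> and \<open>G\<close> range over
  all finite simple graphs.
\<close>

definition blowup_bounds :: "'a pair_pre_digraph \<Rightarrow> real set" where
  "blowup_bounds H =
     {\<alpha>. 0 \<le> \<alpha> \<and>
        (\<exists>F :: nat pair_pre_digraph. pair_graph F \<and>
           (\<forall>G :: nat pair_pre_digraph.
              pair_graph G \<and> maximal_free H G \<and>
              \<alpha> * real (card (pverts G)) \<le> real (min_degree G)
              \<longrightarrow> is_blowup F G))}"

definition blowup_threshold :: "'a pair_pre_digraph \<Rightarrow> real" where
  "blowup_threshold H = Inf (blowup_bounds H)"

definition blowup_thresholds :: "real set" where
  "blowup_thresholds =
     {blowup_threshold H | H :: nat pair_pre_digraph. pair_graph H \<and> 3 \<le> chromatic_number H}"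

text \<open>The infimum is taken over a nonempty set that is bounded below, so it is genuine.\<close>

lemma min_degree_less_card:
  assumes "pair_graph G" "pverts G \<noteq> {}"
  shows "min_degree G < card (pverts G)"
proof -
  interpret pair_graph G by fact
  obtain v where v: "v \<in> pverts G" using assms(2) by blast
  have "out_arcs (with_proj G) v \<subseteq> Pair v ` (pverts G - {v})"
    using pair_no_loops wellformed' by (fastforce simp: out_arcs_def)
  then have "out_degree (with_proj G) v \<le> card (Pair v ` (pverts G - {v}))"
    unfolding out_degree_def by (intro card_mono) (auto simp: pair_finite_verts)
  also have "\<dots> \<le> card (pverts G - {v})"
    by (rule card_image_le) (auto simp: pair_finite_verts)
  also have "\<dots> < card (pverts G)"
    using v pair_finite_verts by (intro psubset_card_mono) auto
  finally have "out_degree (with_proj G) v < card (pverts G)" .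
  moreover have "min_degree G \<le> out_degree (with_proj G) v"
    using v pair_finite_verts by (auto simp: min_degree_def)
  ultimately show ?thesis by linarith
qed

lemma one_in_blowup_bounds: "1 \<in> blowup_bounds H"
proof -
  let ?F = "\<lparr>pverts = {}, parcs = {}\<rparr> :: nat pair_pre_digraph"
  have F: "pair_graph ?F"
    by unfold_locales (auto simp: symmetric_def sym_def)
  have "is_blowup ?F G"
    if "pair_graph G" "1 * real (card (pverts G)) \<le> real (min_degree G)"
    for G :: "nat pair_pre_digraph"
  proof -
    interpret pair_graph G by fact
    have "pverts G = {}" using min_degree_less_card[OF that(1)] that(2) by fastforce
    then have "parcs G = {}" using wellformed' by fastforce
    with \<open>pverts G = {}\<close> show ?thesis by (simp add: is_blowup_def disjoint_family_on_def)
  qed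
  with F show ?thesis unfolding blowup_bounds_def by fastforce
qed

lemma bdd_below_blowup_bounds: "bdd_below (blowup_bounds H)"
  by (auto simp: blowup_bounds_def intro: bdd_belowI[of _ 0])

end

theory Submission
  imports Defs "HOL-Library.FuncSet"
begin

text \<open>
  Let \<open>R\<close> be a core of \<open>H\<close>, that is, the subgraph induced on the image of an endomorphism of \<open>H\<close> whose
  image is as small as possible. Then \<open>H\<close> maps to \<open>R\<close>, and every endomorphism of \<open>R\<close> is an automorphism
  (\<open>ex_core\<close>). The number \<open>1 / (3 |R|)\<close> is a lower bound for the blowup threshold: given any
  graph \<open>F\<close>, there is a maximal \<open>H\<close>-free graph on \<open>n\<close> vertices of minimum degree at least
  \<open>n / (3 |R|)\<close> that is not a blowup of \<open>F\<close>.

  Take \<open>N\<close> copies \<open>(v, 1), \<dots>, (v, N)\<close> of every vertex \<open>v\<close> of \<open>R\<close>. Choose an edge \<open>xy\<close> of \<open>R\<close> that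
  lies on a cycle; one exists because \<open>R\<close> is not bipartite. Join \<open>(v, a)\<close> to \<open>(w, b)\<close> when \<open>vw\<close> is
  an edge of \<open>R\<close> and the labels satisfy \<open>a = b\<close>, except over the edge \<open>xy\<close>, where the
  condition is \<open>a \<noteq> b\<close>. To make degrees linear, join all the copies of \<open>v\<close> to a new set of \<open>N\<close> vertices, and that
  set to a further set of \<open>N\<close> vertices.

  This gadget is \<open>H\<close>-free (\<open>no_hom_to_gadget\<close>). Indeed it maps to \<open>R\<close>, so a homomorphism
  from \<open>R\<close> to it may be taken, after composing with an automorphism of \<open>R\<close>, to be a section of
  this projection. The neighbours of a new vertex all project to the same vertex of \<open>R\<close>, so the vertices
  of \<open>R\<close> on cycles, having at least two neighbours, are sent to copies of themselves. Following a
  cycle through \<open>xy\<close>, the label is the same at \<open>x\<close> and at \<open>y\<close>, but the edge \<open>xy\<close> forces distinct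
  labels.

  Extend the gadget to a maximal \<open>H\<close>-free graph \<open>G\<close> on the same vertices. If \<open>G\<close> were a blowup of
  \<open>F\<close>, then for \<open>N\<close> large the pigeonhole principle would give more than \<open>|H|\<close> labels such that,
  for every \<open>v\<close>, the copies of \<open>v\<close> with these labels lie in one part of the blowup. Such copies have
  equal neighbourhoods in \<open>G\<close>, so the conditions on labels become void: \<open>G\<close> contains a complete
  blowup of \<open>R\<close> with parts larger than \<open>|H|\<close>, and hence \<open>H\<close> (\<open>blowup_gadget_contains\<close>).
\<close>

section \<open>Graph homomorphisms and copies\<close>

text \<open>Only the values of \<open>f\<close> on the vertices of \<open>G\<close> matter.\<close>

definition graph_hom :: "('a \<Rightarrow> 'b) \<Rightarrow> 'a pair_pre_digraph \<Rightarrow> 'b pair_pre_digraph \<Rightarrow> bool" where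
  "graph_hom f G H \<longleftrightarrow>
     f ` pverts G \<subseteq> pverts H \<and> (\<forall>(x, y)\<in>parcs G. (f x, f y) \<in> parcs H)"

lemma graph_hom_vertex: "graph_hom f G H \<Longrightarrow> x \<in> pverts G \<Longrightarrow> f x \<in> pverts H"
  by (auto simp: graph_hom_def)

lemma graph_hom_arc: "graph_hom f G H \<Longrightarrow> (x, y) \<in> parcs G \<Longrightarrow> (f x, f y) \<in> parcs H"
  by (auto simp: graph_hom_def)

lemma graph_hom_comp: "graph_hom f G H \<Longrightarrow> graph_hom g H K \<Longrightarrow> graph_hom (g \<circ> f) G K"
  by (auto simp: graph_hom_def)

lemma pair_graphI:
  assumes "finite V" "E \<subseteq> V \<times> V" "sym E" "irrefl E"
  shows "pair_graph \<lparr>pverts = V, parcs = E\<rparr>"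
  using assms finite_subset[OF assms(2)]
  by unfold_locales (auto simp: symmetric_def irrefl_def)

lemma pair_graphD:
  assumes "pair_graph G"
  shows "finite (pverts G)" "parcs G \<subseteq> pverts G \<times> pverts G" "sym (parcs G)" "irrefl (parcs G)"
proof -
  interpret pair_graph G by fact
  show "finite (pverts G)" "parcs G \<subseteq> pverts G \<times> pverts G"
    using pair_finite_verts wellformed' by auto
  show "sym (parcs G)" "irrefl (parcs G)"
    using arcs_symmetric pair_no_loops by (fastforce simp: sym_def irrefl_def)+
qed

lemma contains_copy_imp_hom:
  assumes "contains_copy H G"
  shows "\<exists>f. graph_hom f H G"
proof -
  obtain K h where K: "subgraph (with_proj K) (with_proj G)"
    and h: "pre_digraph.digraph_isomorphism (with_proj H) h" "with_proj K = app_iso h (with_proj H)"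
    using assms unfolding contains_copy_def digraph_iso_def by blast
  have sub: "pverts K \<subseteq> pverts G" "parcs K \<subseteq> parcs G"
    using K by (simp_all add: subgraph_def)
  from h(2) have eqs: "pverts K = iso_verts h ` pverts H" "parcs K = iso_arcs h ` parcs H"
    "iso_tail h = fst" "iso_head h = snd"
    by (auto simp: with_proj_def app_iso_def)
  have "(iso_verts h x, iso_verts h y) = iso_arcs h (x, y)" if "(x, y) \<in> parcs H" for x y
    using h(1) that eqs(3,4) by (auto simp: pre_digraph.digraph_isomorphism_def prod_eq_iff)
  then have "graph_hom (iso_verts h) H G"
    using sub eqs by (force simp: graph_hom_def)
  then show ?thesis by blast
qed

lemma inj_hom_imp_contains_copy:
  assumes H: "pair_graph H" and G: "pair_graph G"
    and f: "graph_hom f H G" "inj_on f (pverts H)"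
  shows "contains_copy H G"
proof -
  interpret H: pair_graph H by fact
  interpret G: pair_graph G by fact
  define K where "K = \<lparr>pverts = f ` pverts H, parcs = map_prod f f ` parcs H\<rparr>"
  define h where "h = \<lparr>iso_verts = f, iso_arcs = map_prod f f, iso_head = snd, iso_tail = fst\<rparr>"
  have "inj_on (map_prod f f) (parcs H)"
    by (rule inj_on_subset[OF map_prod_inj_on[OF f(2) f(2)]]) (rule pair_graphD(2)[OF H])
  then have "H.digraph_isomorphism h"
    using f(2) H.wf_digraph by (auto simp: H.digraph_isomorphism_def h_def)
  moreover have "with_proj K = app_iso h (with_proj H)"
    by (simp add: with_proj_def K_def h_def app_iso_def)
  moreover have "wf_digraph (with_proj K)"
    using pair_graphD(2)[OF H] by unfold_locales (auto simp: K_def)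
  then have "subgraph (with_proj K) (with_proj G)"
    using f(1) G.wf_digraph by (auto simp: subgraph_def K_def graph_hom_def compatible_def)
  ultimately show ?thesis
    unfolding contains_copy_def digraph_iso_def by blast
qed

lemma ex_maximal_free_supergraph:
  assumes G: "pair_graph G" and free: "\<not> contains_copy H G"
  shows "\<exists>G'. pair_graph G' \<and> maximal_free H G' \<and> pverts G' = pverts G \<and> parcs G \<subseteq> parcs G'"
proof -
  let ?V = "pverts G"
  define \<E> where "\<E> = {E. E \<subseteq> ?V \<times> ?V \<and> sym E \<and> irrefl E \<and>
    \<not> contains_copy H \<lparr>pverts = ?V, parcs = E\<rparr>}"
  note G' = pair_graphD[OF G]
  have "finite \<E>"
    by (rule finite_subset[of _ "Pow (?V \<times> ?V)"]) (auto simp: \<E>_def G')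
  moreover have "parcs G \<in> \<E>"
  proof -
    have "\<lparr>pverts = ?V, parcs = parcs G\<rparr> = G" by simp
    then show ?thesis using G' free by (simp only: \<E>_def mem_Collect_eq simp_thms)
  qed
  ultimately obtain E where E: "E \<in> \<E>" "parcs G \<subseteq> E" "\<And>E'. E' \<in> \<E> \<Longrightarrow> E \<subseteq> E' \<Longrightarrow> E = E'"
    using finite_has_maximal2[of \<E> "parcs G"] by auto
  let ?G' = "\<lparr>pverts = ?V, parcs = E\<rparr>"
  have "contains_copy H (add_edge ?G' u v)" if uv: "u \<in> ?V" "v \<in> ?V" "u \<noteq> v" "(u, v) \<notin> E" for u v
  proof (rule ccontr)
    assume "\<not> contains_copy H (add_edge ?G' u v)"
    then have "E \<union> {(u, v), (v, u)} \<in> \<E>"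
      using E(1) uv by (auto simp: \<E>_def add_edge_def sym_def irrefl_def)
    then have "E = E \<union> {(u, v), (v, u)}"
      by (rule E(3)) blast
    then show False using uv(4) by blast
  qed
  then have "maximal_free H ?G'"
    using E(1) by (auto simp: maximal_free_def \<E>_def)
  moreover have "pair_graph ?G'"
    using E(1) G'(1) by (intro pair_graphI) (auto simp: \<E>_def)
  ultimately show ?thesis
    using E(2) by (intro exI[of _ ?G']) simp
qed

section \<open>Cores\<close>

text \<open>For a finite graph, an injective endomorphism is an automorphism.\<close>

definition is_core :: "'a pair_pre_digraph \<Rightarrow> bool" where
  "is_core R \<longleftrightarrow> (\<forall>\<sigma>. graph_hom \<sigma> R R \<longrightarrow> inj_on \<sigma> (pverts R))"

lemma ex_core:
  fixes H :: "'a pair_pre_digraph"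
  assumes H: "pair_graph H"
  shows "\<exists>R \<phi>. pair_graph R \<and> is_core R \<and> graph_hom id R H \<and> graph_hom \<phi> H R"
proof -
  note H' = pair_graphD[OF H]
  have "graph_hom id H H" by (auto simp: graph_hom_def)
  then obtain \<phi> where \<phi>: "graph_hom \<phi> H H"
    and min: "\<And>\<psi>. graph_hom \<psi> H H \<Longrightarrow> card (\<phi> ` pverts H) \<le> card (\<psi> ` pverts H)"
    using ex_has_least_nat[of "\<lambda>\<phi>. graph_hom \<phi> H H" id "\<lambda>\<phi>. card (\<phi> ` pverts H)"] by blast
  define S where "S = \<phi> ` pverts H"
  define R where "R = \<lparr>pverts = S, parcs = parcs H \<inter> S \<times> S\<rparr>"
  have S: "S \<subseteq> pverts H" "finite S"
    using \<phi> H'(1) by (auto simp: S_def graph_hom_def)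
  have "pair_graph R"
    unfolding R_def using S(2) H' by (intro pair_graphI) (auto simp: sym_def irrefl_def)
  moreover have hom: "graph_hom id R H" "graph_hom \<phi> H R"
    using S(1) \<phi> H'(2) by (auto simp: R_def graph_hom_def S_def)
  moreover have "is_core R"
    unfolding is_core_def
  proof (intro allI impI)
    fix \<sigma> assume \<sigma>: "graph_hom \<sigma> R R"
    have "graph_hom (id \<circ> (\<sigma> \<circ> \<phi>)) H H"
      using hom \<sigma> by (blast intro: graph_hom_comp)
    from min[OF this] have "card S \<le> card (\<sigma> ` S)"
      by (simp add: S_def image_comp)
    with card_image_le[OF S(2), of \<sigma>] show "inj_on \<sigma> (pverts R)"
      using S(2) by (simp add: R_def inj_on_iff_eq_card)
  qed
  ultimately show ?thesis by blast
qed

lemma core_no_isolated: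
  assumes "is_core R" "(p, q) \<in> parcs R" "pair_graph R" "v \<in> pverts R"
  shows "\<exists>w. (v, w) \<in> parcs R"
proof (rule ccontr)
  assume isolated: "\<nexists>w. (v, w) \<in> parcs R"
  note R = pair_graphD[OF assms(3)]
  have "(w, v) \<notin> parcs R" for w
    using isolated R(3) by (auto dest: symD)
  then have "graph_hom (id(v := p)) R R"
    using isolated assms(2) R(2) by (auto simp: graph_hom_def)
  then have "inj_on (id(v := p)) (pverts R)"
    using assms(1) by (simp add: is_core_def)
  moreover have "p \<noteq> v" "p \<in> pverts R"
    using isolated assms(2) R(2) by auto
  ultimately show False
    using assms(4) by (auto simp: inj_on_def)
qed

text \<open>
  If \<open>g\<close> maps a core into a graph over it, then \<open>\<pi> \<circ> g\<close> is an automorphism, and composing \<open>g\<close>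
  with its inverse gives a section of \<open>\<pi>\<close>.
\<close>

lemma core_section:
  assumes core: "is_core R" and R: "pair_graph R"
    and hom: "graph_hom g R G" "graph_hom \<pi> G R"
  shows "\<exists>s. graph_hom s R G \<and> (\<forall>x\<in>pverts R. \<pi> (s x) = x)"
proof -
  note R' = pair_graphD[OF R]
  define \<sigma> where "\<sigma> = \<pi> \<circ> g"
  have \<sigma>: "graph_hom \<sigma> R R"
    unfolding \<sigma>_def using hom by (rule graph_hom_comp)
  then have inj: "inj_on \<sigma> (pverts R)"
    using core by (simp add: is_core_def)
  then have surj: "\<sigma> ` pverts R = pverts R"
    using \<sigma> R'(1) by (intro endo_inj_surj) (auto simp: graph_hom_def)
  have "inj_on (map_prod \<sigma> \<sigma>) (parcs R)"
    by (rule inj_on_subset[OF map_prod_inj_on[OF inj inj]]) (rule R'(2))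
  moreover have "finite (parcs R)"
    using finite_subset[OF R'(2)] R'(1) by simp
  moreover have "map_prod \<sigma> \<sigma> ` parcs R \<subseteq> parcs R"
    using graph_hom_arc[OF \<sigma>] by auto
  ultimately have arcs: "map_prod \<sigma> \<sigma> ` parcs R = parcs R"
    by (intro endo_inj_surj)
  define \<tau> where "\<tau> = the_inv_into (pverts R) \<sigma>"
  have \<tau>: "\<tau> (\<sigma> x) = x" if "x \<in> pverts R" for x
    using inj that by (simp add: \<tau>_def the_inv_into_f_f)
  have "graph_hom \<tau> R R"
    unfolding graph_hom_def
  proof safe
    fix x assume "x \<in> pverts R"
    then have "x \<in> \<sigma> ` pverts R" using surj by simp
    then show "\<tau> x \<in> pverts R" using \<tau> by auto
  next
    fix x y assume "(x, y) \<in> parcs R"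
    then have "(x, y) \<in> map_prod \<sigma> \<sigma> ` parcs R" using arcs by simp
    then show "(\<tau> x, \<tau> y) \<in> parcs R" using \<tau> R'(2) by auto
  qed
  then have "graph_hom (g \<circ> \<tau>) R G"
    using hom(1) by (rule graph_hom_comp)
  moreover have "\<pi> ((g \<circ> \<tau>) x) = x" if "x \<in> pverts R" for x
  proof -
    from that have "x \<in> \<sigma> ` pverts R" using surj by simp
    then show ?thesis using \<tau> by (auto simp: \<sigma>_def)
  qed
  ultimately show ?thesis by blast
qed

section \<open>Edges on cycles of a non-bipartite graph\<close>

text \<open>
  Bipartiteness as a property of the edge set alone, so that it can be applied to sets of edges
  on a fixed vertex set.
\<close>

definition two_colorable :: "'a rel \<Rightarrow> bool" where
  "two_colorable E \<longleftrightarrow> (\<exists>c :: 'a \<Rightarrow> bool. \<forall>(x, y)\<in>E. c x \<noteq> c y)"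

text \<open>
  A minimal non-bipartite set \<open>D\<close> of edges (in fact an odd cycle) has no bridge: the ends of each
  of its edges are still connected once that edge is removed.
\<close>

lemma ex_bridgeless:
  assumes "finite E" "sym E" "\<not> two_colorable E"
  shows "\<exists>D\<subseteq>E. D \<noteq> {} \<and> sym D \<and> (\<forall>(x, y)\<in>D. (x, y) \<in> (D - {(x, y), (y, x)})\<^sup>*)"
proof -
  define \<D> where "\<D> = {D. D \<subseteq> E \<and> sym D \<and> \<not> two_colorable D}"
  have "finite \<D>" "E \<in> \<D>"
    using assms by (auto simp: \<D>_def)
  then obtain D where D: "D \<in> \<D>" and min: "\<And>D'. D' \<in> \<D> \<Longrightarrow> D' \<subseteq> D \<Longrightarrow> D = D'"
    using finite_has_minimal2[of \<D> E] by auto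
  have no_coloring: "\<not> (\<forall>(p, q)\<in>D. c p \<noteq> c q)" for c :: "'a \<Rightarrow> bool"
    using D unfolding \<D>_def two_colorable_def by blast
  have "(x, y) \<in> (D - {(x, y), (y, x)})\<^sup>*" if xy: "(x, y) \<in> D" for x y
  proof (rule ccontr)
    let ?D = "D - {(x, y), (y, x)}"
    assume disconnected: "(x, y) \<notin> ?D\<^sup>*"
    have sym: "sym ?D" using D by (auto simp: \<D>_def sym_def)
    have "?D \<notin> \<D>" using min[of ?D] xy by blast
    then have "two_colorable ?D" using D sym by (auto simp: \<D>_def)
    then obtain c :: "'a \<Rightarrow> bool" where c: "\<And>p q. (p, q) \<in> ?D \<Longrightarrow> c p \<noteq> c q"
      unfolding two_colorable_def by blast
    have eq: "c x = c y"
    proof (rule ccontr)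
      assume "c x \<noteq> c y"
      then have "\<forall>(p, q)\<in>D. c p \<noteq> c q" using c by blast
      then show False using no_coloring[of c] by blast
    qed
    \<comment> \<open>Swapping the colours on the component of \<open>x\<close> repairs the removed edge.\<close>
    define c' where "c' z = (c z \<noteq> ((x, z) \<in> ?D\<^sup>*))" for z
    have "c' p \<noteq> c' q" if "(p, q) \<in> ?D" for p q
    proof -
      have "(q, p) \<in> ?D" using sym that by (rule symD)
      with that have "(x, p) \<in> ?D\<^sup>* \<longleftrightarrow> (x, q) \<in> ?D\<^sup>*"
        by (meson rtrancl.rtrancl_into_rtrancl)
      then show ?thesis using c[OF that] by (auto simp: c'_def)
    qed
    moreover have "c' x \<noteq> c' y"
      using eq disconnected by (auto simp: c'_def)
    ultimately have "c' p \<noteq> c' q" if "(p, q) \<in> D" for p q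
      using that by (cases "(p, q) \<in> ?D") fastforce+
    then show False using no_coloring[of c'] by blast
  qed
  moreover have "D \<noteq> {}" using no_coloring[of "\<lambda>_. True"] by auto
  moreover have "D \<subseteq> E" "sym D" using D by (simp_all add: \<D>_def)
  ultimately show ?thesis by blast
qed

lemma chromatic_number_ge_3_imp_not_two_colorable:
  assumes "pair_graph H" "3 \<le> chromatic_number H"
  shows "\<not> two_colorable (parcs H)"
proof
  assume "two_colorable (parcs H)"
  then obtain c :: "'a \<Rightarrow> bool" where "\<forall>(x, y)\<in>parcs H. c x \<noteq> c y"
    unfolding two_colorable_def by (elim exE)
  then have "proper_coloring H 2 (\<lambda>x. of_bool (c x))"
    by (auto simp: proper_coloring_def)
  then have "chromatic_number H \<le> 2"
    unfolding chromatic_number_def by (intro Least_le exI)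
  with assms(2) show False by simp
qed

lemma two_colorable_hom:
  assumes "graph_hom f G H" "two_colorable (parcs H)"
  shows "two_colorable (parcs G)"
proof -
  obtain c :: "_ \<Rightarrow> bool" where c: "\<forall>(x, y)\<in>parcs H. c x \<noteq> c y"
    using assms(2) unfolding two_colorable_def by (elim exE)
  have "\<forall>(x, y)\<in>parcs G. (c \<circ> f) x \<noteq> (c \<circ> f) y"
    using c graph_hom_arc[OF assms(1)] by auto
  then show ?thesis unfolding two_colorable_def by (rule exI[of _ "c \<circ> f"])
qed

section \<open>The construction\<close>

text \<open>
  The layers over a vertex \<open>v\<close> of \<open>R\<close>: the copies of \<open>v\<close> itself are \<open>Inner\<close>; they are all joined
  to the \<open>Middle\<close> vertices over \<open>v\<close>, which are also joined to the \<open>Outer\<close> ones. The last two layers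
  only serve to provide large degrees.
\<close>

datatype layer = Inner | Middle | Outer

lemma UNIV_layer: "UNIV = {Inner, Middle, Outer}"
  using layer.exhaust by blast

lemma finite_UNIV_layer: "finite (UNIV :: layer set)"
  by (simp add: UNIV_layer)

text \<open>
  The vertex \<open>(v, k, a)\<close> lies in layer \<open>k\<close> over \<open>v\<close> and has label \<open>a\<close>. Labels of adjacent inner
  vertices agree, except over the edge \<open>xy\<close>, where they differ.
\<close>

definition gadget ::
    "'a pair_pre_digraph \<Rightarrow> 'a \<Rightarrow> 'a \<Rightarrow> nat \<Rightarrow> ('a \<times> layer \<times> nat) pair_pre_digraph" where
  "gadget R x y N =
     \<lparr>pverts = pverts R \<times> UNIV \<times> {..<N},
      parcs = {((v, k, a), (w, l, b)) | v k a w l b.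
        v \<in> pverts R \<and> w \<in> pverts R \<and> a < N \<and> b < N \<and>
        (k = Inner \<and> l = Inner \<and> (v, w) \<in> parcs R \<and> (a = b \<longleftrightarrow> (v, w) \<notin> {(x, y), (y, x)})
         \<or> v = w \<and> (k = Middle) \<noteq> (l = Middle))}\<rparr>"

lemma pair_graph_gadget:
  assumes "pair_graph R"
  shows "pair_graph (gadget R x y N)"
  unfolding gadget_def
  using pair_graphD[OF assms]
  by (intro pair_graphI) (auto simp: sym_def irrefl_def finite_UNIV_layer)

lemma card_gadget: "card (pverts (gadget R x y N)) = 3 * card (pverts R) * N"
  by (simp add: gadget_def card_cartesian_product UNIV_layer)

lemma degree_gadget:
  assumes "pair_graph R" "u \<in> pverts (gadget R x y N)"
  shows "N \<le> card {z. (u, z) \<in> parcs (gadget R x y N)}"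
proof -
  obtain v k a where u: "u = (v, k, a)" "v \<in> pverts R" "a < N"
    using assms(2) by (auto simp: gadget_def)
  let ?l = "if k = Middle then Outer else Middle"
  have "(\<lambda>b. (v, ?l, b)) ` {..<N} \<subseteq> {z. (u, z) \<in> parcs (gadget R x y N)}"
    using u by (auto simp: gadget_def)
  moreover have "finite {z. (u, z) \<in> parcs (gadget R x y N)}"
    using pair_graphD(1,2)[OF pair_graph_gadget[OF assms(1), of x y N]]
    by (auto intro!: finite_subset[of _ "pverts (gadget R x y N)"])
  ultimately have "card ((\<lambda>b. (v, ?l, b)) ` {..<N}) \<le> card {z. (u, z) \<in> parcs (gadget R x y N)}"
    by (intro card_mono)
  then show ?thesis by (simp add: card_image inj_on_def)
qed

lemma no_hom_to_gadget:
  assumes core: "is_core R" and R: "pair_graph R"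
    and D: "D \<subseteq> parcs R" "sym D" "\<forall>(p, q)\<in>D. (p, q) \<in> (D - {(p, q), (q, p)})\<^sup>*"
    and xy: "(x, y) \<in> D"
  shows "\<not> graph_hom g R (gadget R x y N)"
proof
  let ?G = "gadget R x y N"
  assume g: "graph_hom g R ?G"
  note R' = pair_graphD[OF R]
  have "\<forall>v\<in>pverts R. \<exists>w. (v, w) \<in> parcs R"
    using core_no_isolated[OF core _ R] xy D(1) by blast
  then obtain nb where nb: "\<And>v. v \<in> pverts R \<Longrightarrow> (v, nb v) \<in> parcs R"
    by metis
  have nb_vertex: "nb v \<in> pverts R" if "v \<in> pverts R" for v
    using nb[OF that] R'(2) by auto
  \<comment> \<open>A middle vertex over \<open>v\<close> is adjacent to vertices projecting to \<open>v\<close> only, so it may be sent to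
    any neighbour of \<open>v\<close>.\<close>
  define \<pi> :: "'a \<times> layer \<times> nat \<Rightarrow> 'a" where
    "\<pi> = (\<lambda>(v, k, a). if k = Middle then nb v else v)"
  have "graph_hom \<pi> ?G R"
    using nb nb_vertex symD[OF R'(3)] by (auto simp: graph_hom_def \<pi>_def gadget_def)
  then obtain s where s: "graph_hom s R ?G" and proj: "\<And>v. v \<in> pverts R \<Longrightarrow> \<pi> (s v) = v"
    using core_section[OF core R g] by blast
  have arc: "(s p, s q) \<in> parcs ?G" "\<pi> (s p) = p" "\<pi> (s q) = q" if "(p, q) \<in> D" for p q
    using graph_hom_arc[OF s] proj that D(1) R'(2) by auto
  have inner: "\<exists>a. s p = (p, Inner, a)" if pq: "(p, q) \<in> D" for p q
  proof -
    have "p \<noteq> q" using pq D(1) R'(4) by (auto simp: irrefl_def)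
    moreover have "(p, q) \<in> (D - {(p, q), (q, p)})\<^sup>*" using D(3) pq by blast
    ultimately obtain r where r: "(p, r) \<in> D" "r \<noteq> q"
      by (auto elim: converse_rtranclE)
    \<comment> \<open>The neighbours of a middle or outer vertex all have the same image under \<open>\<pi>\<close>, but \<open>s p\<close>
      has neighbours projecting to \<open>q\<close> and to \<open>r\<close>.\<close>
    show ?thesis
      using arc[OF pq] arc[OF r(1)] r(2) by (auto simp: gadget_def \<pi>_def split: if_splits)
  qed
  have label: "snd (snd (s p)) = snd (snd (s q)) \<longleftrightarrow> (p, q) \<notin> {(x, y), (y, x)}" if "(p, q) \<in> D" for p q
  proof -
    have "(q, p) \<in> D" using D(2) that by (rule symD)
    with inner that obtain a b where "s p = (p, Inner, a)" "s q = (q, Inner, b)" by meson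
    with arc(1)[OF that] show ?thesis by (auto simp: gadget_def)
  qed
  have "snd (snd (s x)) = snd (snd (s z))" if "(x, z) \<in> (D - {(x, y), (y, x)})\<^sup>*" for z
    using that by (induction rule: rtrancl_induct) (use label in auto)
  then have "snd (snd (s x)) = snd (snd (s y))" using D(3) xy by blast
  then show False using label[OF xy] by simp
qed

section \<open>Bounded blowups of the construction\<close>

text \<open>
  A blowup of \<open>F\<close> has a projection onto \<open>F\<close> that reflects adjacency as well as preserving it;
  vertices with the same projection have the same neighbours.
\<close>

lemma blowup_projection:
  assumes "pair_graph F" "is_blowup F G"
  shows "\<exists>\<kappa>. (\<forall>u\<in>pverts G. \<kappa> u \<in> pverts F) \<and>
    (\<forall>u\<in>pverts G. \<forall>v\<in>pverts G. (u, v) \<in> parcs G \<longleftrightarrow> (\<kappa> u, \<kappa> v) \<in> parcs F)"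
proof -
  obtain B where B: "disjoint_family_on B (pverts F)" "pverts G = (\<Union>x\<in>pverts F. B x)"
    "parcs G = (\<Union>(x, y)\<in>parcs F. B x \<times> B y)"
    using assms(2) by (auto simp: is_blowup_def)
  have "\<forall>u\<in>pverts G. \<exists>x\<in>pverts F. u \<in> B x" using B(2) by blast
  then obtain \<kappa> where \<kappa>: "\<And>u. u \<in> pverts G \<Longrightarrow> \<kappa> u \<in> pverts F \<and> u \<in> B (\<kappa> u)" by metis
  have unique: "x = \<kappa> u" if "x \<in> pverts F" "u \<in> B x" for x u
  proof -
    have "\<kappa> u \<in> pverts F" "u \<in> B (\<kappa> u)" using \<kappa>[of u] B(2) that by auto
    then show ?thesis using B(1) that unfolding disjoint_family_on_def by blast
  qed
  have "(u, v) \<in> parcs G \<longleftrightarrow> (\<kappa> u, \<kappa> v) \<in> parcs F" if "u \<in> pverts G" "v \<in> pverts G" for u v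
    using \<kappa>[OF that(1)] \<kappa>[OF that(2)] unique pair_graphD(2)[OF assms(1)] unfolding B(3) by blast
  with \<kappa> show ?thesis by blast
qed

lemma pigeonhole_fibre:
  assumes "finite B" "f ` A \<subseteq> B" "card B * t < card A"
  shows "\<exists>y. t < card {x \<in> A. f x = y}"
proof (rule ccontr)
  assume "\<nexists>y. t < card {x \<in> A. f x = y}"
  then have le: "card {x \<in> A. f x = y} \<le> t" for y by (simp add: not_less)
  have "A = (\<Union>y\<in>B. {x \<in> A. f x = y})" using assms(2) by auto
  then have "card A \<le> (\<Sum>y\<in>B. card {x \<in> A. f x = y})"
    using card_UN_le[OF assms(1)] by metis
  also have "\<dots> \<le> card B * t" using le sum_bounded_above[of B _ t] by simp
  finally show False using assms(3) by simp
qed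

text \<open>
  The bound on \<open>N\<close> exceeds \<open>|H| + 1\<close> times the number of maps from \<open>R\<close> to \<open>F\<close>: a set of more than
  \<open>|H| + 1\<close> labels inducing the same map leaves distinct labels for all the vertices of \<open>H\<close>, and
  contains two distinct labels even if \<open>H\<close> is empty.
\<close>

lemma blowup_gadget_contains:
  assumes H: "pair_graph H" and R: "pair_graph R" and \<phi>: "graph_hom \<phi> H R"
    and G: "pair_graph G" and \<iota>: "graph_hom \<iota> (gadget R x y N) G" "inj_on \<iota> (pverts (gadget R x y N))"
    and F: "pair_graph F" "is_blowup F G"
    and N: "card (pverts F) ^ card (pverts R) * Suc (card (pverts H)) < N"
  shows "contains_copy H G"
proof -
  note H' = pair_graphD[OF H] and R' = pair_graphD[OF R] and F' = pair_graphD[OF F(1)]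
  let ?C = "gadget R x y N"
  obtain \<kappa> where \<kappa>: "\<And>u. u \<in> pverts G \<Longrightarrow> \<kappa> u \<in> pverts F"
    and adj: "\<And>u v. u \<in> pverts G \<Longrightarrow> v \<in> pverts G \<Longrightarrow> (u, v) \<in> parcs G \<longleftrightarrow> (\<kappa> u, \<kappa> v) \<in> parcs F"
    using blowup_projection[OF F] by blast
  define e where "e v a = \<iota> (v, Inner, a)" for v a
  have e: "e v a \<in> pverts G" if "v \<in> pverts R" "a < N" for v a
    unfolding e_def using that by (intro graph_hom_vertex[OF \<iota>(1)]) (auto simp: gadget_def)
  define f where "f a = (\<lambda>v\<in>pverts R. \<kappa> (e v a))" for a
  have "f ` {..<N} \<subseteq> (\<Pi>\<^sub>E v\<in>pverts R. pverts F)"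
    using \<kappa> e by (auto simp: f_def)
  then obtain y0 where "Suc (card (pverts H)) < card {a \<in> {..<N}. f a = y0}"
    using pigeonhole_fibre[of "\<Pi>\<^sub>E v\<in>pverts R. pverts F" f "{..<N}" "Suc (card (pverts H))"] N F'(1) R'(1)
    by (auto simp: finite_PiE card_PiE)
  then obtain I where I: "I \<subseteq> {..<N}" "Suc (card (pverts H)) < card I" "\<And>a. a \<in> I \<Longrightarrow> f a = y0"
    by (metis (mono_tags, lifting) mem_Collect_eq subsetI)
  have "finite I" using I(1) finite_subset by blast
  have \<kappa>_eq: "\<kappa> (e v a) = \<kappa> (e v b)" if "a \<in> I" "b \<in> I" "v \<in> pverts R" for v a b
    using I(3)[OF that(1)] I(3)[OF that(2)] that(3) by (auto simp: f_def dest: fun_cong[of _ _ v])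
  obtain i where i: "i ` pverts H \<subseteq> I" "inj_on i (pverts H)"
    using card_le_inj[OF H'(1) \<open>finite I\<close>] I(2) by auto
  obtain a b where ab: "a \<in> I" "b \<in> I" "a \<noteq> b"
    using card_le_Suc0_iff_eq[OF \<open>finite I\<close>] I(2) by fastforce
  have complete: "(e v c, e w d) \<in> parcs G" if vw: "(v, w) \<in> parcs R" and cd: "c \<in> I" "d \<in> I" for v w c d
  proof -
    have vw': "v \<in> pverts R" "w \<in> pverts R" using vw R'(2) by auto
    \<comment> \<open>The labels \<open>a\<close> and \<open>b'\<close> satisfy the condition over \<open>vw\<close>; they may be exchanged for \<open>c\<close> and
      \<open>d\<close>, since \<open>\<kappa>\<close> does not distinguish labels in \<open>I\<close>.\<close>
    define b' where "b' = (if (v, w) \<in> {(x, y), (y, x)} then b else a)"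
    have b': "b' \<in> I" "a = b' \<longleftrightarrow> (v, w) \<notin> {(x, y), (y, x)}" using ab by (auto simp: b'_def)
    have less: "z < N" if "z \<in> I" for z using I(1) that by auto
    have "((v, Inner, a), (w, Inner, b')) \<in> parcs ?C"
      using vw vw' b' ab less by (auto simp: gadget_def)
    then have "(e v a, e w b') \<in> parcs G"
      unfolding e_def by (rule graph_hom_arc[OF \<iota>(1)])
    then show ?thesis
      using adj e less vw' ab cd b' \<kappa>_eq[of a c v] \<kappa>_eq[of b' d w] by simp
  qed
  have "graph_hom (\<lambda>h. e (\<phi> h) (i h)) H G"
    unfolding graph_hom_def
  proof safe
    fix h assume h: "h \<in> pverts H"
    have "i h < N" using h i(1) I(1) by auto
    then show "e (\<phi> h) (i h) \<in> pverts G"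
      using e graph_hom_vertex[OF \<phi> h] by blast
  next
    fix h h' assume h: "(h, h') \<in> parcs H"
    have "i h \<in> I" "i h' \<in> I" using h H'(2) i(1) by auto
    then show "(e (\<phi> h) (i h), e (\<phi> h') (i h')) \<in> parcs G"
      using complete graph_hom_arc[OF \<phi> h] by blast
  qed
  moreover have "inj_on (\<lambda>h. e (\<phi> h) (i h)) (pverts H)"
  proof (rule inj_onI)
    fix h h' assume h: "h \<in> pverts H" "h' \<in> pverts H" "e (\<phi> h) (i h) = e (\<phi> h') (i h')"
    have "(\<phi> z, Inner, i z) \<in> pverts ?C" if "z \<in> pverts H" for z
      using that graph_hom_vertex[OF \<phi>] i(1) I(1) by (auto simp: gadget_def)
    then have "(\<phi> h, Inner, i h) = (\<phi> h', Inner, i h')"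
      using h by (intro inj_onD[OF \<iota>(2)]) (simp_all add: e_def)
    then have "i h = i h'" by simp
    then show "h = h'" using i(2) h by (auto dest: inj_onD)
  qed
  ultimately show ?thesis
    using inj_hom_imp_contains_copy[OF H G] by blast
qed

section \<open>Positivity of the threshold\<close>

lemma min_degree_ge:
  assumes G: "pair_graph G" "pverts G \<noteq> {}"
    and deg: "\<And>v. v \<in> pverts G \<Longrightarrow> N \<le> card {w. (v, w) \<in> parcs G}"
  shows "N \<le> min_degree G"
proof -
  have "out_arcs (with_proj G) v = Pair v ` {w. (v, w) \<in> parcs G}" for v
    by (auto simp: out_arcs_def)
  then have "out_degree (with_proj G) v = card {w. (v, w) \<in> parcs G}" for v
    by (simp add: out_degree_def card_image inj_on_def)
  then show ?thesis
    using G(2) deg pair_graphD(1)[OF G(1)] by (simp add: min_degree_def)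
qed

lemma ex_dense_maximal_free_non_blowup:
  fixes H :: "'a pair_pre_digraph" and F :: "nat pair_pre_digraph"
  assumes H: "pair_graph H" and R: "pair_graph R" "is_core R" "graph_hom id R H" "graph_hom \<phi> H R"
    and odd: "\<not> two_colorable (parcs R)" and F: "pair_graph F"
  shows "\<exists>G :: nat pair_pre_digraph. pair_graph G \<and> maximal_free H G \<and> \<not> is_blowup F G \<and>
    card (pverts G) \<le> 3 * card (pverts R) * min_degree G"
proof -
  note R' = pair_graphD[OF R(1)]
  have "finite (parcs R)" using R'(1,2) finite_subset by blast
  then obtain D where D: "D \<subseteq> parcs R" "sym D" "\<forall>(p, q)\<in>D. (p, q) \<in> (D - {(p, q), (q, p)})\<^sup>*"
    and "D \<noteq> {}"
    using ex_bridgeless[OF _ R'(3) odd] by blast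
  then obtain x y where xy: "(x, y) \<in> D" by auto
  define N where "N = Suc (card (pverts F) ^ card (pverts R) * Suc (card (pverts H)))"
  let ?C = "gadget R x y N"
  have C: "pair_graph ?C" using R(1) by (rule pair_graph_gadget)
  note C' = pair_graphD[OF C]
  obtain \<iota> :: "'a \<times> layer \<times> nat \<Rightarrow> nat" where \<iota>: "inj_on \<iota> (pverts ?C)"
    using finite_imp_inj_to_nat_seg[OF C'(1)] by blast
  \<comment> \<open>The gadget is copied to the natural numbers, over which the threshold quantifies.\<close>
  define G0 where "G0 = \<lparr>pverts = \<iota> ` pverts ?C, parcs = map_prod \<iota> \<iota> ` parcs ?C\<rparr>"
  have G0: "pair_graph G0"
    unfolding G0_def
  proof (rule pair_graphI)
    show "sym (map_prod \<iota> \<iota> ` parcs ?C)" using C'(3) by (force simp: sym_def)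
    show "irrefl (map_prod \<iota> \<iota> ` parcs ?C)"
      using C'(2,4) inj_onD[OF \<iota>] by (fastforce simp: irrefl_def)
  qed (use C'(1,2) in auto)
  have "graph_hom (the_inv_into (pverts ?C) \<iota>) G0 ?C"
    using C'(2) the_inv_into_f_f[OF \<iota>] by (fastforce simp: graph_hom_def G0_def)
  then have "\<not> contains_copy H G0"
    using no_hom_to_gadget[OF R(2,1) D xy] contains_copy_imp_hom graph_hom_comp R(3) by metis
  then obtain G where G: "pair_graph G" "maximal_free H G" "pverts G = pverts G0" "parcs G0 \<subseteq> parcs G"
    using ex_maximal_free_supergraph[OF G0] by blast
  have hom: "graph_hom \<iota> ?C G"
    using G(3,4) by (auto simp: graph_hom_def G0_def)
  have "\<not> is_blowup F G"
  proof
    assume "is_blowup F G"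
    then have "contains_copy H G"
      using blowup_gadget_contains[OF H R(1,4) G(1) hom \<iota> F] by (simp add: N_def)
    then show False using G(2) by (simp add: maximal_free_def)
  qed
  moreover have "N \<le> min_degree G"
  proof (rule min_degree_ge[OF G(1)])
    have "x \<in> pverts R" using xy D(1) R'(2) by auto
    then show "pverts G \<noteq> {}" by (auto simp: G(3) G0_def gadget_def N_def)
  next
    fix v assume "v \<in> pverts G"
    then obtain u where u: "u \<in> pverts ?C" "v = \<iota> u" by (auto simp: G(3) G0_def)
    let ?A = "{z. (u, z) \<in> parcs ?C}"
    have "?A \<subseteq> pverts ?C" using C'(2) by auto
    then have "card ?A = card (\<iota> ` ?A)"
      using card_image inj_on_subset[OF \<iota>] by metis
    also have "\<dots> \<le> card {w. (v, w) \<in> parcs G}"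
    proof (rule card_mono)
      show "finite {w. (v, w) \<in> parcs G}"
        using pair_graphD(1,2)[OF G(1)] by (auto intro: finite_subset[of _ "pverts G"])
      show "\<iota> ` ?A \<subseteq> {w. (v, w) \<in> parcs G}"
        using graph_hom_arc[OF hom] u(2) by blast
    qed
    finally show "N \<le> card {w. (v, w) \<in> parcs G}"
      using degree_gadget[OF R(1) u(1)] by simp
  qed
  moreover have "card (pverts G) = 3 * card (pverts R) * N"
    using card_image[OF \<iota>] by (simp add: G(3) G0_def card_gadget)
  ultimately show ?thesis using G(1,2) by auto
qed

lemma blowup_threshold_pos:
  fixes H :: "'a pair_pre_digraph"
  assumes H: "pair_graph H" "3 \<le> chromatic_number H"
  shows "0 < blowup_threshold H"
proof -
  obtain R \<phi> where R: "pair_graph R" "is_core R" "graph_hom id R H" "graph_hom \<phi> H R"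
    using ex_core[OF H(1)] by blast
  have odd: "\<not> two_colorable (parcs R)"
    using chromatic_number_ge_3_imp_not_two_colorable[OF H] two_colorable_hom[OF R(4)] by blast
  then have "parcs R \<noteq> {}" by (auto simp: two_colorable_def)
  then have "0 < card (pverts R)"
    using pair_graphD(1,2)[OF R(1)] by (auto simp: card_gt_0_iff)
  define \<beta> where "\<beta> = 1 / (3 * real (card (pverts R)))"
  have \<beta>: "0 < \<beta>" using \<open>0 < card (pverts R)\<close> by (simp add: \<beta>_def)
  have "\<beta> \<le> \<alpha>" if \<alpha>: "\<alpha> \<in> blowup_bounds H" for \<alpha>
  proof (rule ccontr)
    assume "\<not> \<beta> \<le> \<alpha>"
    obtain F :: "nat pair_pre_digraph" where F: "pair_graph F"
      and blowup: "\<And>G :: nat pair_pre_digraph. pair_graph G \<Longrightarrow> maximal_free H G \<Longrightarrow>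
        \<alpha> * real (card (pverts G)) \<le> real (min_degree G) \<Longrightarrow> is_blowup F G"
      using \<alpha> unfolding blowup_bounds_def by blast
    obtain G :: "nat pair_pre_digraph" where G: "pair_graph G" "maximal_free H G" "\<not> is_blowup F G"
      and le: "card (pverts G) \<le> 3 * card (pverts R) * min_degree G"
      using ex_dense_maximal_free_non_blowup[OF H(1) R odd F] by blast
    have "\<alpha> * real (card (pverts G)) \<le> \<beta> * real (card (pverts G))"
      using \<open>\<not> \<beta> \<le> \<alpha>\<close> by (intro mult_right_mono) auto
    also have "\<dots> \<le> \<beta> * real (3 * card (pverts R) * min_degree G)"
      using le \<beta> by (intro mult_left_mono of_nat_mono) auto
    also have "\<dots> = real (min_degree G)"
      using \<open>0 < card (pverts R)\<close> by (simp add: \<beta>_def)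
    finally show False using blowup G by blast
  qed
  then have "\<beta> \<le> blowup_threshold H"
    unfolding blowup_threshold_def using one_in_blowup_bounds by (intro cInf_greatest) blast+
  with \<beta> show ?thesis by simp
qed

theorem theorem1p1:
  shows "(\<forall>H :: 'a pair_pre_digraph.
            pair_graph H \<and> 3 \<le> chromatic_number H \<longrightarrow> 0 < blowup_threshold H)
         \<and> 0 \<notin> blowup_thresholds"
  by (auto simp: blowup_thresholds_def dest: blowup_threshold_pos)

end
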